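(* Let $G$ be a finite directed multigraph. The face poset of the cycle polytope $P(G)$ is isomorphic to the poset of full subgraphs of $G$ (ordered by inclusion of edge sets) via the map $$H\mapsto P(G)_H:=\{\vec x\in P(G)\mid x_e=0 \text{ for all } e\notin E(H)\}.$$ Moreover, identifying $P(H)$ with its image under the canonical injection $\mathbb R^{E(H)}\hookrightarrow\mathbb R^{E(G)}$, one has $P(H)=P(G)_H$. In particular, $\dim P(G)_H=|E(H)|-|V(H)|+|\{\text{connected components of } H\}|-1$.
   Context: Directed multigraphs may have multiple edges and loops. A cycle in a directed multigraph $G=(V,E)$ is a closed walk $e_1,\dots,e_n$ of edges ($n\ge1$, the head of $e_i$ is the tail of $e_{i+1}$, indices mod $n$), of length $|\mathcal C|=n$; it is simple if it does not repeat vertices. For a non-empty cycle $\mathcal C$, $\vec e_{\mathcal C}\in\mathbb R^E$ is defined by $(\vec e_{\mathcal C})_e=(\text{number of occurrences of } e \text{ in } \mathcal C)/|\mathcal C|$, and the cycle polytope is $P(G)=\operatorname{conv}\{\vec e_{\mathcal C}: \mathcal C \text{ a simple cycle of } G\}$. A directed multigraph is full if each of its edges is contained in a cycle of it; a full subgraph $H$ of $G$ is a subgraph which is full, determined by its edge set $E(H)$ with vertex set $V(H)$ the endpoints of these edges (the empty subgraph corresponds to the empty face). Connected components are in the weak sense; dimension of a polytope is that of its affine hull. *)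

theory Defs
  imports
    "HOL-Analysis.Analysis"
    "Graph_Theory.Digraph_Component"
begin

text \<open>
  A finite directed multigraph is a \<open>fin_digraph\<close>, whose edge set \<open>arcs G\<close> may be any subset of the
  finite type \<open>'e\<close>. For \<open>F \<subseteq> UNIV :: 'e set\<close>, the space of real vectors indexed by \<open>F\<close> is the
  coordinate subspace of \<open>real ^ 'e\<close> of vectors vanishing outside \<open>F\<close>. So for a subgraph \<open>H\<close> of \<open>G\<close>
  the canonical injection from the vectors indexed by \<open>arcs H\<close> into those indexed by \<open>arcs G\<close>
  is the inclusion, and the polytopes of \<open>H\<close> and of \<open>G\<close> can be compared as sets.
\<close>

definition cycle_vec :: "'e list \<Rightarrow> real ^ 'e::finite" where
  "cycle_vec p = (\<chi> e. real (count_list p e) / real (length p))"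

text \<open>\<open>pre_digraph.cycle\<close> is the notion of a simple cycle (loops included);
  arbitrary non-empty cycles are \<open>wf_digraph.closed_w\<close>.\<close>

definition cycle_polytope :: "('v, 'e::finite) pre_digraph \<Rightarrow> (real ^ 'e) set" where
  "cycle_polytope G = convex hull (cycle_vec ` {p. pre_digraph.cycle G p})"

definition full :: "('v, 'e) pre_digraph \<Rightarrow> bool" where
  "full G \<longleftrightarrow> (\<forall>e \<in> arcs G. \<exists>p. wf_digraph.closed_w G p \<and> e \<in> set p)"

text \<open>The last conjunct excludes isolated vertices, so that a full subgraph is determined by its
  edge set: \<open>subgraph\<close> already forces \<open>tail\<close> and \<open>head\<close> to agree with those of \<open>G\<close>.\<close>

definition full_subgraphs :: "('v, 'e) pre_digraph \<Rightarrow> ('v, 'e) pre_digraph set" where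
  "full_subgraphs G =
    {H. subgraph H G \<and> full H \<and> verts H = tail H ` arcs H \<union> head H ` arcs H}"

definition polytope_restrict ::
    "('v, 'e::finite) pre_digraph \<Rightarrow> ('v, 'e) pre_digraph \<Rightarrow> (real ^ 'e) set" where
  "polytope_restrict G H = {x \<in> cycle_polytope G. \<forall>e \<in> arcs G - arcs H. x $ e = 0}"

text \<open>\<open>Digraph_Component.connected\<close> is connectedness of the underlying undirected graph and
  excludes the empty graph, which therefore has no components.\<close>

definition weak_components :: "('v, 'e) pre_digraph \<Rightarrow> ('v, 'e) pre_digraph set" where
  "weak_components G = {K. pre_digraph.max_subgraph G Digraph_Component.connected K}"

end

theory Submission
  imports Defs
begin

text \<open>
  By Krein--Milman, the cycle polytope is the set of nonnegative circulations of total mass one. If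
  \<open>z\<close> is supported where \<open>y\<close> is, then \<open>y\<close> can be pushed slightly away from \<open>z\<close> without leaving this
  set. Hence an extreme point equals the vector of any simple cycle in its support, and a face is
  determined by the arcs on which some of its points are positive. A full subgraph carries a
  circulation positive on all its arcs, so its polytope spans the space of all its circulations,
  which is the orthogonal complement of the cut space.
\<close>

section \<open>Circulations and the polytope of nonnegative circulations of mass one\<close>

text \<open>The transposed incidence matrix applied to a vertex potential \<open>f\<close>; the
  range of this map is the cut space.\<close>

definition coboundary :: "('v, 'e::finite) pre_digraph \<Rightarrow> ('v \<Rightarrow> real) \<Rightarrow> real ^ 'e" where
  "coboundary G f = (\<chi> e. if e \<in> arcs G then f (head G e) - f (tail G e) else 0)"

text \<open>Orthogonality to the coboundary of the indicator of \<open>v\<close> is flow conservation at \<open>v\<close>.\<close>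

definition circulations :: "('v, 'e::finite) pre_digraph \<Rightarrow> (real ^ 'e) set" where
  "circulations G = {x. (\<forall>e. e \<notin> arcs G \<longrightarrow> x $ e = 0) \<and> (\<forall>f. coboundary G f \<bullet> x = 0)}"

definition circulation_polytope :: "('v, 'e::finite) pre_digraph \<Rightarrow> (real ^ 'e) set" where
  "circulation_polytope G = {x \<in> circulations G. (\<forall>e. 0 \<le> x $ e) \<and> (\<Sum>e\<in>UNIV. x $ e) = 1}"

lemma coboundary_inner:
  "coboundary G f \<bullet> x = (\<Sum>e\<in>arcs G. (f (head G e) - f (tail G e)) * x $ e)"
proof -
  have "coboundary G f \<bullet> x
      = (\<Sum>e\<in>UNIV. if e \<in> arcs G then (f (head G e) - f (tail G e)) * x $ e else 0)"
    unfolding inner_vec_def coboundary_def by (intro sum.cong) auto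
  then show ?thesis by (simp add: sum.If_cases)
qed

lemma subspace_circulations: "subspace (circulations G)"
  unfolding subspace_def circulations_def by (auto simp: inner_simps)

lemma convex_circulation_polytope:
  fixes G :: "('v, 'e::finite) pre_digraph"
  shows "convex (circulation_polytope G)"
proof -
  have "circulation_polytope G
      = circulations G \<inter> (\<Inter>e. {x. 0 \<le> x $ e}) \<inter> {x. (\<Sum>e\<in>UNIV. x $ e) = 1}"
    by (auto simp: circulation_polytope_def)
  moreover have "convex {x :: real ^ 'e. (\<Sum>e\<in>UNIV. x $ e) = 1}"
    by (auto simp: convex_def sum.distrib simp flip: sum_distrib_left)
  moreover have "convex (\<Inter>e. {x :: real ^ 'e. 0 \<le> x $ e})"
    by (intro convex_INT) (auto simp: convex_def)
  ultimately show ?thesis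
    by (simp add: convex_Int subspace_imp_convex subspace_circulations)
qed

lemma compact_circulation_polytope:
  fixes G :: "('v, 'e::finite) pre_digraph"
  shows "compact (circulation_polytope G)"
proof -
  have "closed (circulation_polytope G)"
  proof -
    have "circulation_polytope G = circulations G \<inter> {x. (\<forall>e. 0 \<le> x $ e)}
        \<inter> {x. (\<Sum>e\<in>UNIV. x $ e) = 1}"
      by (auto simp: circulation_polytope_def)
    moreover have "closed {x :: real ^ 'e. (\<forall>e. 0 \<le> x $ e)}"
      by (intro closed_Collect_all closed_Collect_le continuous_intros)
    moreover have "closed {x :: real ^ 'e. (\<Sum>e\<in>UNIV. x $ e) = 1}"
      by (intro closed_Collect_eq continuous_intros)
    ultimately show ?thesis
      using closed_subspace[OF subspace_circulations] by (metis closed_Int)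
  qed
  moreover have "bounded (circulation_polytope G)"
  proof (rule boundedI)
    fix x assume x: "x \<in> circulation_polytope G"
    have "norm x \<le> (\<Sum>e\<in>UNIV. \<bar>x $ e\<bar>)" by (rule norm_le_l1_cart)
    also have "\<dots> = 1" using x by (simp add: circulation_polytope_def)
    finally show "norm x \<le> 1" .
  qed
  ultimately show ?thesis by (simp add: compact_eq_bounded_closed)
qed

section \<open>Supports and faces\<close>

text \<open>Each of the finitely many inequalities holds for all small \<open>t > 0\<close>:
  trivially where \<open>y\<close> vanishes, by continuity elsewhere. Such a \<open>t\<close> keeps
  both \<open>y - t *\<^sub>R z\<close> and \<open>y + t *\<^sub>R z\<close> nonnegative.\<close>

lemma ex_small_multiple:
  fixes y z :: "real ^ 'e"
  assumes nonneg: "\<And>e. 0 \<le> y $ e" and supp: "\<And>e. y $ e = 0 \<Longrightarrow> z $ e = 0"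
  obtains t where "0 < t" "t < 1" "\<And>e. t * \<bar>z $ e\<bar> \<le> y $ e"
proof -
  have "\<forall>\<^sub>F t in at_right 0. t * \<bar>z $ e\<bar> \<le> y $ e" for e
  proof (cases "y $ e = 0")
    case False
    then have "0 * \<bar>z $ e\<bar> < y $ e" using nonneg[of e] by simp
    moreover have "((\<lambda>t. t * \<bar>z $ e\<bar>) \<longlongrightarrow> 0 * \<bar>z $ e\<bar>) (at_right 0)"
      by (intro tendsto_intros)
    ultimately show ?thesis
      by (auto elim!: eventually_mono dest!: order_tendstoD(2))
  qed (simp add: supp)
  then have "\<forall>\<^sub>F t in at_right 0. \<forall>e. t * \<bar>z $ e\<bar> \<le> y $ e"
    by (rule eventually_all_finite)
  moreover have "\<forall>\<^sub>F t :: real in at_right 0. 0 < t \<and> t < 1"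
    by (simp add: eventually_at_right_field) (use zero_less_one in blast)
  ultimately have "\<forall>\<^sub>F t in at_right 0. 0 < t \<and> t < 1 \<and> (\<forall>e. t * \<bar>z $ e\<bar> \<le> y $ e)"
    by eventually_elim auto
  then obtain t where "0 < t \<and> t < 1 \<and> (\<forall>e. t * \<bar>z $ e\<bar> \<le> y $ e)"
    using eventually_happens by fastforce
  then show ?thesis using that by blast
qed

text \<open>A point \<open>z\<close> supported where \<open>y\<close> is lies on a segment of the polytope that has \<open>y\<close> in
  its interior.\<close>

lemma face_of_circulation_polytope_support:
  assumes F: "F face_of circulation_polytope G" and y: "y \<in> F"
    and z: "z \<in> circulation_polytope G" and supp: "\<And>e. y $ e = 0 \<Longrightarrow> z $ e = 0"
  shows "z \<in> F"
proof -
  have yP: "y \<in> circulation_polytope G" using F y face_of_imp_subset by blast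
  then obtain t where t: "0 < t" "t < 1" "\<And>e. t * \<bar>z $ e\<bar> \<le> y $ e"
    using ex_small_multiple[of y z] supp by (auto simp: circulation_polytope_def)
  \<comment> \<open>The point reached by continuing the segment from \<open>z\<close> slightly past
    \<open>y\<close>; the factor \<open>1 / (1 - t)\<close> restores total mass one.\<close>
  define w where "w = (1 / (1 - t)) *\<^sub>R (y - t *\<^sub>R z)"
  have y_eq: "y = (1 - t) *\<^sub>R w + t *\<^sub>R z" using t by (simp add: w_def)
  have "w \<in> circulations G"
    unfolding w_def using yP z
    by (intro subspace_scale subspace_diff subspace_circulations)
      (auto simp: circulation_polytope_def)
  moreover have "0 \<le> w $ e" for e
    using t(2) t(3)[of e] z by (auto simp: w_def circulation_polytope_def)
  moreover have "(\<Sum>e\<in>UNIV. w $ e) = 1"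
  proof -
    have "(\<Sum>e\<in>UNIV. w $ e) = (1 / (1 - t)) * ((\<Sum>e\<in>UNIV. y $ e) - t * (\<Sum>e\<in>UNIV. z $ e))"
      by (simp add: w_def sum_subtractf flip: sum_distrib_left sum_divide_distrib)
    then show ?thesis using yP z t by (simp add: circulation_polytope_def)
  qed
  ultimately have w: "w \<in> circulation_polytope G" by (auto simp: circulation_polytope_def)
  show ?thesis
  proof (cases "w = z")
    case True
    then have "y = z" using y_eq by (simp flip: scaleR_add_left)
    then show ?thesis using y by simp
  next
    case False
    then have "y \<in> open_segment w z" using t y_eq by (auto simp: in_segment)
    then show ?thesis using F w z y by (auto simp: face_of_def)
  qed
qed

section \<open>Closed walks, simple cycles and circulations\<close>

lemma (in pre_digraph) sum_list_potential_diff_cas: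
  assumes "cas u p v"
  shows "(\<Sum>e\<leftarrow>p. f (head G e) - f (tail G e)) = (f v - f u :: real)"
  using assms by (induction p arbitrary: u) auto

lemma sum_list_eq_sum_count:
  fixes f :: "'e::finite \<Rightarrow> real"
  shows "(\<Sum>e\<leftarrow>p. f e) = (\<Sum>e\<in>UNIV. real (count_list p e) * f e)"
proof (induction p)
  case (Cons a p)
  have "(\<Sum>e\<in>UNIV. real (count_list (a # p) e) * f e)
      = (\<Sum>e\<in>UNIV. real (count_list p e) * f e + (if a = e then f e else 0))"
    by (intro sum.cong) (auto simp: algebra_simps)
  then show ?case using Cons by (simp add: sum.distrib)
qed simp

lemma cycle_vec_nth_pos_iff: "0 < cycle_vec p $ e \<longleftrightarrow> e \<in> set p"
proof -
  have "0 < count_list p e \<longleftrightarrow> e \<in> set p" by (metis count_list_0_iff neq0_conv)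
  then show ?thesis by (auto simp: cycle_vec_def zero_less_divide_iff)
qed

text \<open>Pairing with a coboundary adds up the potential differences along \<open>p\<close>,
  which telescope to zero on a closed walk; dividing by the length makes the mass one.\<close>

lemma cycle_vec_in_circulation_polytope:
  fixes H :: "('c, 'e::finite) pre_digraph"
  assumes "wf_digraph H" "wf_digraph.closed_w H p"
  shows "cycle_vec p \<in> circulation_polytope H"
proof -
  interpret H: wf_digraph H by fact
  obtain u where u: "H.awalk u p u" and ne: "p \<noteq> []"
    using assms by (auto simp: H.closed_w_def)
  have arcs: "set p \<subseteq> arcs H" and cas: "H.cas u p u" using u by auto
  have "coboundary H f \<bullet> cycle_vec p = 0" for f
  proof -
    have "coboundary H f \<bullet> cycle_vec p
        = (\<Sum>e\<in>arcs H. real (count_list p e) * (f (head H e) - f (tail H e))) / real (length p)"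
      by (simp add: coboundary_inner cycle_vec_def sum_divide_distrib mult.commute)
    also have "(\<Sum>e\<in>arcs H. real (count_list p e) * (f (head H e) - f (tail H e)))
        = (\<Sum>e\<leftarrow>p. f (head H e) - f (tail H e))"
      unfolding sum_list_eq_sum_count using arcs
      by (intro sum.mono_neutral_left) (auto simp: count_list_0_iff)
    also have "\<dots> = 0" using H.sum_list_potential_diff_cas[OF cas] by simp
    finally show ?thesis by simp
  qed
  moreover have "(\<Sum>e\<in>UNIV. cycle_vec p $ e) = 1"
    using sum_count_set[of p UNIV] ne
    by (simp add: cycle_vec_def flip: sum_divide_distrib of_nat_sum)
  ultimately show ?thesis using arcs
    by (auto simp: circulation_polytope_def circulations_def cycle_vec_def count_list_0_iff)
qed

text \<open>Following a chosen successor arc forever must revisit an arc, as there are finitely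
  many; the arcs from one visit up to a later one form a closed walk.\<close>

lemma (in wf_digraph) closed_w_if_all_continue:
  assumes fin: "finite (arcs G)" and ne: "arcs G \<noteq> {}"
    and continue: "\<And>e. e \<in> arcs G \<Longrightarrow> \<exists>e'\<in>arcs G. tail G e' = head G e"
  shows "\<exists>p. closed_w p"
proof -
  obtain f where f: "\<And>e. e \<in> arcs G \<Longrightarrow> f e \<in> arcs G \<and> tail G (f e) = head G e"
    using continue by metis
  obtain e\<^sub>0 where e\<^sub>0: "e\<^sub>0 \<in> arcs G" using ne by blast
  define a where "a i = (f ^^ i) e\<^sub>0" for i
  have a_arcs: "a i \<in> arcs G" for i
    by (induction i) (use e\<^sub>0 f in \<open>auto simp: a_def\<close>)
  have a_Suc: "tail G (a (Suc i)) = head G (a i)" for i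
    using f[OF a_arcs[of i]] by (simp add: a_def)
  have cas: "cas (tail G (a i)) (map a [i..<i + k]) (tail G (a (i + k)))" for i k
  proof (induction k arbitrary: i)
    case (Suc k)
    have "[i..<i + Suc k] = i # [Suc i..<Suc i + k]" by (simp add: upt_conv_Cons)
    then show ?case using Suc[of "Suc i"] a_Suc[of i] by simp
  qed simp
  have "\<not> inj a"
    using fin a_arcs by (metis finite_imageD finite_subset image_subsetI infinite_UNIV_nat)
  then obtain i j where "i < j" "a i = a j"
    unfolding inj_on_def by (metis linorder_neqE_nat)
  then have "awalk (tail G (a i)) (map a [i..<j]) (tail G (a i))"
    using cas[of i "j - i"] a_arcs by (auto simp: awalk_def)
  then show ?thesis using \<open>i < j\<close> by (auto simp: closed_w_def)
qed

lemma (in wf_digraph) subgraph_cycle_imp_cycle: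
  assumes "pre_digraph.cycle H p" "subgraph H G"
  shows "cycle p"
  using assms subgraph_awalk_imp_awalk
  by (metis compatible_awalk_verts pre_digraph.cycle_def subgraphE)

lemma (in wf_digraph) cycle_imp_closed_w: "cycle p \<Longrightarrow> closed_w p"
  by (auto simp: cycle_def closed_w_def)

text \<open>At the head of an arc that carries flow, conservation forces an arc with flow to leave.
  Hence \<open>closed_w_if_all_continue\<close> applies to the support of \<open>x\<close>, and a
  closed walk there yields a simple cycle.\<close>

lemma circulation_polytope_ex_cycle:
  assumes "wf_digraph G" and x: "x \<in> circulation_polytope G"
  obtains p where "pre_digraph.cycle G p" "\<And>e. e \<in> set p \<Longrightarrow> x $ e \<noteq> 0"
proof -
  interpret wf_digraph G by fact
  define S where "S = G\<lparr>arcs := {e. 0 < x $ e}\<rparr>"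
  have nonneg: "0 \<le> x $ e" and outside: "e \<notin> arcs G \<Longrightarrow> x $ e = 0" for e
    using x by (auto simp: circulation_polytope_def circulations_def)
  have arcs_S: "arcs S \<subseteq> arcs G" using outside by (force simp: S_def)
  interpret S: wf_digraph S
    using arcs_S by unfold_locales (auto simp: S_def)
  have sub: "subgraph S G"
    using arcs_S S.wf_digraph wf_digraph by (auto simp: subgraph_def compatible_def S_def)
  have "\<exists>p. S.closed_w p"
  proof (rule S.closed_w_if_all_continue)
    show "finite (arcs S)" by simp
    have "(\<Sum>e\<in>UNIV. x $ e) \<noteq> 0" using x by (simp add: circulation_polytope_def)
    then obtain e where "x $ e \<noteq> 0" by (meson sum.neutral)
    then have "e \<in> arcs S" using nonneg[of e] by (simp add: S_def)
    then show "arcs S \<noteq> {}" by blast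
  next
    fix e assume e: "e \<in> arcs S"
    show "\<exists>e'\<in>arcs S. tail S e' = head S e"
    proof (rule ccontr)
      assume "\<not> ?thesis"
      then have no_out: "x $ e' = 0" if "tail G e' = head G e" for e'
        using that nonneg[of e'] by (force simp: S_def)
      \<comment> \<open>Pairing with this cut measures inflow minus outflow at the head of
        \<open>e\<close>; without outflow it is at least \<open>x $ e\<close>, contradicting
        conservation.\<close>
      let ?f = "indicator {head G e} :: _ \<Rightarrow> real"
      have "0 < (\<Sum>e'\<in>arcs G. ?f (head G e') * x $ e')"
        using e arcs_S nonneg
        by (intro sum_pos2[of _ e]) (auto simp: S_def)
      also have "\<dots> = coboundary G ?f \<bullet> x"
        unfolding coboundary_inner
        by (intro sum.cong) (auto simp: indicator_def no_out)
      also have "\<dots> = 0" using x by (simp add: circulation_polytope_def circulations_def)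
      finally show False by simp
    qed
  qed
  then obtain p where "S.cycle p" using S.closed_w_imp_cycle by blast
  moreover from this have "set p \<subseteq> arcs S" by (auto simp: S.cycle_def)
  ultimately show ?thesis
    using that subgraph_cycle_imp_cycle[OF _ sub] by (force simp: S_def)
qed

theorem cycle_polytope_eq_circulation_polytope:
  assumes "wf_digraph G"
  shows "cycle_polytope G = circulation_polytope G"
proof
  interpret wf_digraph G by fact
  show "cycle_polytope G \<subseteq> circulation_polytope G"
    unfolding cycle_polytope_def using cycle_imp_closed_w assms
    by (intro hull_minimal convex_circulation_polytope)
      (auto intro: cycle_vec_in_circulation_polytope)
  have "x \<in> cycle_vec ` {p. cycle p}" if x: "x extreme_point_of circulation_polytope G" for x
  proof -
    have xP: "x \<in> circulation_polytope G" using x by (simp add: extreme_point_of_def)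
    obtain p where p: "cycle p" "\<And>e. e \<in> set p \<Longrightarrow> x $ e \<noteq> 0"
      using circulation_polytope_ex_cycle[OF assms xP] by blast
    \<comment> \<open>An extreme point is a face by itself, and a face contains every point of the
      polytope whose support lies within that of one of its points.\<close>
    have "cycle_vec p \<in> {x}"
    proof (rule face_of_circulation_polytope_support)
      show "{x} face_of circulation_polytope G" using x by (simp add: face_of_singleton)
      show "cycle_vec p \<in> circulation_polytope G"
        using p assms by (simp add: cycle_vec_in_circulation_polytope cycle_imp_closed_w)
      show "cycle_vec p $ e = 0" if "x $ e = 0" for e
        using p(2) that by (auto simp: cycle_vec_def count_list_0_iff)
    qed simp
    then show ?thesis using p by auto
  qed
  then show "circulation_polytope G \<subseteq> cycle_polytope G"
    unfolding cycle_polytope_def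
    using Krein_Milman_Minkowski[OF compact_circulation_polytope convex_circulation_polytope, of G]
    by (metis (mono_tags, lifting) hull_mono mem_Collect_eq subsetI)
qed

section \<open>Full subgraphs and the faces of the polytope\<close>

text \<open>A closed walk through \<open>e\<close> gives a point positive at \<open>e\<close>.
  Conversely, if no closed walk passes through \<open>e\<close>, the vectors of simple cycles vanish
  there, hence so does their convex hull, which is the whole circulation polytope.\<close>

lemma full_iff_circulation:
  assumes "wf_digraph H"
  shows "full H \<longleftrightarrow> (\<forall>e\<in>arcs H. \<exists>x\<in>circulation_polytope H. 0 < x $ e)"
proof
  interpret wf_digraph H by fact
  assume "full H"
  then show "\<forall>e\<in>arcs H. \<exists>x\<in>circulation_polytope H. 0 < x $ e"
    unfolding full_def using cycle_vec_in_circulation_polytope[OF assms]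
    by (meson cycle_vec_nth_pos_iff)
next
  interpret wf_digraph H by fact
  assume pos: "\<forall>e\<in>arcs H. \<exists>x\<in>circulation_polytope H. 0 < x $ e"
  show "full H"
    unfolding full_def
  proof (rule ballI, rule ccontr)
    fix e assume e: "e \<in> arcs H" and "\<not> (\<exists>p. closed_w p \<and> e \<in> set p)"
    then have "cycle_vec ` {p. cycle p} \<subseteq> {x. x $ e = 0}"
      using cycle_imp_closed_w by (auto simp: cycle_vec_def count_list_0_iff)
    then have "cycle_polytope H \<subseteq> {x. x $ e = 0}"
      unfolding cycle_polytope_def by (rule hull_minimal) (auto simp: convex_def)
    then show False
      using pos e cycle_polytope_eq_circulation_polytope[OF assms] by force
  qed
qed

text \<open>The average over all \<open>e\<close> of points with positive \<open>e\<close>-coordinate, where such points exist.\<close>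

lemma convex_ex_full_support:
  fixes C :: "(real ^ 'e) set"
  assumes "convex C" "C \<noteq> {}" "\<And>x e. x \<in> C \<Longrightarrow> 0 \<le> x $ e"
  obtains y where "y \<in> C" "\<And>x e. x \<in> C \<Longrightarrow> y $ e = 0 \<Longrightarrow> x $ e = 0"
proof -
  obtain x\<^sub>0 where x\<^sub>0: "x\<^sub>0 \<in> C" using assms by blast
  \<comment> \<open>Where all of \<open>C\<close> vanishes at \<open>e\<close>, any point of
    \<open>C\<close> will do; \<open>x\<^sub>0\<close> keeps the average inside
    \<open>C\<close>.\<close>
  define g where "g e = (if \<exists>x\<in>C. 0 < x $ e then SOME x. x \<in> C \<and> 0 < x $ e else x\<^sub>0)" for e
  have g: "g e \<in> C" "(\<exists>x\<in>C. 0 < x $ e) \<Longrightarrow> 0 < g e $ e" for e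
    using x\<^sub>0 someI_ex[of "\<lambda>x. x \<in> C \<and> 0 < x $ e"] unfolding g_def by auto
  define y where "y = (\<Sum>e\<in>UNIV. (1 / real CARD('e)) *\<^sub>R g e)"
  show ?thesis
  proof
    show "y \<in> C"
      unfolding y_def using assms(1) g(1) by (intro convex_sum) auto
    fix x e assume x: "x \<in> C" and y0: "y $ e = 0"
    have "0 \<le> g e' $ e" for e' using assms(3) g(1) by blast
    moreover have "(\<Sum>e'\<in>UNIV. g e' $ e) = 0"
      using y0 by (simp add: y_def flip: sum_divide_distrib)
    ultimately have "g e $ e = 0" by (simp add: sum_nonneg_eq_0_iff)
    then show "x $ e = 0" using g(2)[of e] assms(3)[OF x, of e] x by force
  qed
qed

text \<open>For \<open>x\<close> vanishing on the arcs of \<open>G\<close> outside \<open>H\<close>,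
  those arcs contribute nothing to the conservation sums, so \<open>H\<close> and \<open>G\<close>
  impose the same conditions. Since \<open>cycle_polytope H\<close> is also the circulation polytope
  of \<open>H\<close>, it equals \<open>polytope_restrict G H\<close>.\<close>

lemma polytope_restrict_eq_circulation_polytope:
  assumes "subgraph H G"
  shows "polytope_restrict G H = circulation_polytope H"
proof -
  have wf: "wf_digraph G" and arcs: "arcs H \<subseteq> arcs G"
    and ends: "tail H = tail G" "head H = head G"
    using assms by (auto simp: compatible_def)
  have inner: "coboundary H f \<bullet> x = coboundary G f \<bullet> x"
    if "\<And>e. e \<in> arcs G - arcs H \<Longrightarrow> x $ e = 0" for f x
    unfolding coboundary_inner ends using arcs that
    by (intro sum.mono_neutral_left) auto
  have "x \<in> polytope_restrict G H \<longleftrightarrow> x \<in> circulation_polytope H" for x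
  proof (cases "\<forall>e\<in>arcs G - arcs H. x $ e = 0")
    case True
    then show ?thesis
      using arcs inner[of x]
      by (auto simp: polytope_restrict_def cycle_polytope_eq_circulation_polytope[OF wf]
          circulation_polytope_def circulations_def)
  next
    case False
    then show ?thesis
      by (auto simp: polytope_restrict_def circulation_polytope_def circulations_def)
  qed
  then show ?thesis by blast
qed

text \<open>Coordinates are nonnegative on the polytope, so a proper convex combination of two of
  its points vanishes at \<open>e\<close> only if both points do.\<close>

lemma polytope_restrict_face_of:
  assumes "wf_digraph G"
  shows "polytope_restrict G H face_of cycle_polytope G"
  unfolding face_of_def
proof (intro conjI ballI impI)
  show "polytope_restrict G H \<subseteq> cycle_polytope G"
    by (auto simp: polytope_restrict_def)
  have "convex (\<Inter>e\<in>arcs G - arcs H. {x :: real ^ _. x $ e = 0})"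
    by (intro convex_INT) (auto simp: convex_def)
  moreover have "polytope_restrict G H
      = cycle_polytope G \<inter> (\<Inter>e\<in>arcs G - arcs H. {x. x $ e = 0})"
    by (auto simp: polytope_restrict_def)
  ultimately show "convex (polytope_restrict G H)"
    by (simp add: convex_Int cycle_polytope_def convex_convex_hull)
next
  fix a b x
  assume a: "a \<in> cycle_polytope G" and b: "b \<in> cycle_polytope G"
    and x: "x \<in> polytope_restrict G H" and seg: "x \<in> open_segment a b"
  obtain u where u: "0 < u" "u < 1" "x = (1 - u) *\<^sub>R a + u *\<^sub>R b"
    using seg by (auto simp: in_segment)
  have nonneg: "0 \<le> a $ e" "0 \<le> b $ e" for e
    using a b by (auto simp: cycle_polytope_eq_circulation_polytope[OF assms]
        circulation_polytope_def)
  have "a $ e = 0 \<and> b $ e = 0" if "e \<in> arcs G - arcs H" for e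
  proof -
    have "(1 - u) * a $ e + u * b $ e = 0"
      using x that u(3) by (auto simp: polytope_restrict_def)
    then show ?thesis
      using u(1,2) nonneg[of e] by (simp add: add_nonneg_eq_0_iff)
  qed
  then show "a \<in> polytope_restrict G H" "b \<in> polytope_restrict G H"
    using a b by (auto simp: polytope_restrict_def)
qed

text \<open>Fullness lets the arcs be read off from the face: each arc of \<open>H\<close> is
  positive at some point of its polytope, while points of the polytope of \<open>H'\<close> vanish
  off \<open>arcs H'\<close>.\<close>

lemma full_subgraphs_arcs_mono_iff:
  assumes H: "H \<in> full_subgraphs G" and H': "H' \<in> full_subgraphs G"
  shows "arcs H \<subseteq> arcs H' \<longleftrightarrow> polytope_restrict G H \<subseteq> polytope_restrict G H'"
proof
  assume "arcs H \<subseteq> arcs H'"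
  then show "polytope_restrict G H \<subseteq> polytope_restrict G H'"
    by (auto simp: polytope_restrict_def)
next
  assume sub: "polytope_restrict G H \<subseteq> polytope_restrict G H'"
  show "arcs H \<subseteq> arcs H'"
  proof
    fix e assume e: "e \<in> arcs H"
    have "subgraph H G" "full H" "wf_digraph H" using H by (auto simp: full_subgraphs_def)
    then obtain x where x: "x \<in> polytope_restrict G H" "0 < x $ e"
      using e full_iff_circulation polytope_restrict_eq_circulation_polytope by metis
    then have "x \<in> circulation_polytope H'"
      using sub H' polytope_restrict_eq_circulation_polytope[of H' G]
      by (auto simp: full_subgraphs_def)
    then show "e \<in> arcs H'"
      using x(2) by (force simp: circulation_polytope_def circulations_def)
  qed
qed

lemma full_subgraph_eqI:
  assumes "H \<in> full_subgraphs G" "H' \<in> full_subgraphs G" "arcs H = arcs H'"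
  shows "H = H'"
  using assms by (auto simp: full_subgraphs_def subgraph_def compatible_def)

text \<open>\<open>H\<close> collects the arcs on which some point of \<open>F\<close> is positive.
  If \<open>F\<close> is nonempty, averaging gives a point \<open>y\<close> of \<open>F\<close>
  positive on all of them, and every point of the polytope supported there must lie in
  \<open>F\<close>. The points of \<open>F\<close> also witness that \<open>H\<close> is
  full.\<close>

lemma face_eq_polytope_restrict:
  assumes "wf_digraph G" and F: "F face_of cycle_polytope G"
  obtains H where "H \<in> full_subgraphs G" "F = polytope_restrict G H"
proof -
  interpret wf_digraph G by fact
  define A where "A = {e. \<exists>x\<in>F. 0 < x $ e}"
  define H where "H = G\<lparr>verts := tail G ` A \<union> head G ` A, arcs := A\<rparr>"
  have F': "F face_of circulation_polytope G"
    using F by (simp add: cycle_polytope_eq_circulation_polytope[OF assms(1)])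
  then have FP: "F \<subseteq> circulation_polytope G" by (rule face_of_imp_subset)
  then have nonneg: "0 \<le> x $ e" if "x \<in> F" for x e
    using that by (auto simp: circulation_polytope_def)
  have A: "A \<subseteq> arcs G"
    using FP by (force simp: A_def circulation_polytope_def circulations_def)
  have wf_H: "wf_digraph H" by unfold_locales (auto simp: H_def)
  have sub: "subgraph H G"
    using A wf_H assms(1) by (auto simp: subgraph_def compatible_def H_def)
  have F_eq: "F = polytope_restrict G H"
  proof (cases "F = {}")
    \<comment> \<open>The empty face belongs to the empty subgraph: only the zero vector is
      supported on no arcs, and its mass is not one.\<close>
    case True
    have "x = 0" if "x \<in> polytope_restrict G H" for x
      using that True unfolding polytope_restrict_eq_circulation_polytope[OF sub]
      by (auto simp: circulation_polytope_def circulations_def H_def A_def vec_eq_iff)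
    moreover have "0 \<notin> polytope_restrict G H"
      by (simp add: polytope_restrict_eq_circulation_polytope[OF sub] circulation_polytope_def)
    ultimately show ?thesis using True by blast
  next
    case False
    have "x $ e = 0" if "x \<in> F" "e \<notin> A" for x e
      using that nonneg[of x e] by (force simp: A_def)
    then have "F \<subseteq> polytope_restrict G H"
      using F by (auto simp: polytope_restrict_def H_def dest: face_of_imp_subset)
    moreover obtain y where y: "y \<in> F" "\<And>x e. x \<in> F \<Longrightarrow> y $ e = 0 \<Longrightarrow> x $ e = 0"
      using convex_ex_full_support[OF face_of_imp_convex[OF F] False nonneg]
      by blast
    have "z \<in> F" if z: "z \<in> polytope_restrict G H" for z
    proof (rule face_of_circulation_polytope_support[OF F' y(1)])
      show "z \<in> circulation_polytope G"
        using z by (simp add: polytope_restrict_def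
            cycle_polytope_eq_circulation_polytope[OF assms(1)])
      show "z $ e = 0" if "y $ e = 0" for e
      proof -
        have "e \<notin> A" using y(2)[OF _ that] by (force simp: A_def)
        then show ?thesis
          using z unfolding polytope_restrict_eq_circulation_polytope[OF sub]
          by (simp add: circulation_polytope_def circulations_def H_def)
      qed
    qed
    ultimately show ?thesis by blast
  qed
  have "\<exists>x\<in>F. 0 < x $ e" if "e \<in> arcs H" for e
    using that by (simp add: H_def A_def)
  then have "full H"
    unfolding full_iff_circulation[OF wf_H]
    unfolding F_eq polytope_restrict_eq_circulation_polytope[OF sub] by blast
  then have "H \<in> full_subgraphs G"
    using sub by (simp add: full_subgraphs_def H_def)
  then show ?thesis using that F_eq by blast
qed

section \<open>Affine dimension of the circulation polytope\<close>

text \<open>Fullness provides a point \<open>y\<close> positive on all arcs. A circulation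
  \<open>z\<close> is then a multiple of the difference between the nonnegative circulation
  \<open>y + t *\<^sub>R z\<close> and \<open>y\<close>, so the polytope spans all circulations. It
  lies in a hyperplane missing the origin, which makes its affine dimension one less than its linear
  one.\<close>

lemma aff_dim_circulation_polytope:
  fixes H :: "('v, 'e::finite) pre_digraph"
  assumes "wf_digraph H" "full H" "arcs H \<noteq> {}"
  shows "aff_dim (circulation_polytope H) = int (dim (circulations H)) - 1"
proof -
  let ?P = "circulation_polytope H"
  have pos: "\<exists>x\<in>?P. 0 < x $ e" if "e \<in> arcs H" for e
    using assms(1,2) that by (simp add: full_iff_circulation)
  then have "?P \<noteq> {}" using assms(3) by blast
  moreover have "0 \<le> x $ e" if "x \<in> ?P" for x e
    using that by (simp add: circulation_polytope_def)
  ultimately obtain y where y: "y \<in> ?P" "\<And>x e. x \<in> ?P \<Longrightarrow> y $ e = 0 \<Longrightarrow> x $ e = 0"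
    using convex_ex_full_support[OF convex_circulation_polytope] by blast
  have yZ: "y \<in> circulations H" and y_nonneg: "\<And>e. 0 \<le> y $ e"
    using y(1) by (auto simp: circulation_polytope_def)
  have "z \<in> span ?P" if z: "z \<in> circulations H" for z
  proof -
    have "z $ e = 0" if "y $ e = 0" for e
      using pos[of e] y(2)[OF _ that] z by (force simp: circulations_def)
    then obtain t where t: "0 < t" "\<And>e. t * \<bar>z $ e\<bar> \<le> y $ e"
      using ex_small_multiple[of y z] y_nonneg by blast
    define w where "w = y + t *\<^sub>R z"
    define s where "s = (\<Sum>e\<in>UNIV. w $ e)"
    have wZ: "w \<in> circulations H"
      unfolding w_def using yZ z
      by (intro subspace_add subspace_scale subspace_circulations)
    have w_nonneg: "0 \<le> w $ e" for e
    proof -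
      have "- (t * \<bar>z $ e\<bar>) \<le> t * z $ e" using t(1) by (simp add: abs_if)
      then show ?thesis using t(2)[of e] by (simp add: w_def)
    qed
    have "w \<in> span ?P"
    \<comment> \<open>A nonzero \<open>w\<close> is a positive multiple of a point of the polytope;
      mass zero cannot be normalised but forces \<open>w = 0\<close>.\<close>
    proof (cases "s = 0")
      case True
      then have "w = 0" using w_nonneg by (simp add: s_def sum_nonneg_eq_0_iff vec_eq_iff)
      then show ?thesis by (simp add: span_0)
    next
      case False
      then have "0 < s" using w_nonneg by (simp add: s_def sum_nonneg less_le)
      then have "(1 / s) *\<^sub>R w \<in> ?P"
        using wZ w_nonneg subspace_scale[OF subspace_circulations]
        by (simp add: circulation_polytope_def s_def flip: sum_divide_distrib)
      then have "s *\<^sub>R ((1 / s) *\<^sub>R w) \<in> span ?P"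
        by (intro span_scale span_base)
      then show ?thesis using False by simp
    qed
    then have "(1 / t) *\<^sub>R (w - y) \<in> span ?P"
      using y(1) by (intro span_scale span_diff) (auto intro: span_base)
    then show ?thesis using t(1) by (simp add: w_def)
  qed
  then have "span ?P = circulations H"
    by (intro antisym span_minimal subspace_circulations)
      (auto simp: circulation_polytope_def)
  then have dim: "dim (circulations H) = dim ?P" by (metis dim_span)
  have "affine {x :: real ^ 'e. (\<Sum>e\<in>UNIV. x $ e) = 1}"
    by (auto simp: affine_def sum.distrib simp flip: sum_distrib_left)
  then have "affine hull ?P \<subseteq> {x. (\<Sum>e\<in>UNIV. x $ e) = 1}"
    by (intro hull_minimal) (auto simp: circulation_polytope_def)
  then have "0 \<notin> affine hull ?P" by force
  then have "aff_dim ?P + 1 = aff_dim (insert 0 ?P)" by (simp add: aff_dim_insert)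
  also have "\<dots> = int (dim (insert 0 ?P))"
    by (intro aff_dim_zero hull_inc) simp
  also have "\<dots> = int (dim ?P)" by (simp add: dim_insert span_0)
  finally show ?thesis using dim by simp
qed

section \<open>Weak components as classes of vertices\<close>

definition component_of :: "('v, 'e) pre_digraph \<Rightarrow> 'v \<Rightarrow> 'v set" where
  "component_of G v = {w. v \<rightarrow>\<^sup>*\<^bsub>mk_symmetric G\<^esub> w}"

context wf_digraph
begin

lemma pair_wf_digraph_mk_symmetric: "pair_wf_digraph (mk_symmetric G)"
  ..

lemma component_of_subset_verts: "component_of G v \<subseteq> verts G"
  unfolding component_of_def by (auto elim!: reachable_in_vertsE)

lemma component_of_refl: "v \<in> verts G \<Longrightarrow> v \<in> component_of G v"
  unfolding component_of_def by (simp add: reachable_def)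

lemma component_of_eq_iff:
  assumes "v \<in> verts G" "w \<in> verts G"
  shows "component_of G v = component_of G w \<longleftrightarrow> w \<in> component_of G v"
proof -
  interpret S: pair_wf_digraph "mk_symmetric G" by (rule pair_wf_digraph_mk_symmetric)
  show ?thesis
  proof
    assume "w \<in> component_of G v"
    then have vw: "v \<rightarrow>\<^sup>*\<^bsub>mk_symmetric G\<^esub> w" by (simp add: component_of_def)
    then have wv: "w \<rightarrow>\<^sup>*\<^bsub>mk_symmetric G\<^esub> v"
      by (rule symmetric_reachable[OF symmetric_mk_symmetric])
    show "component_of G v = component_of G w"
      unfolding component_of_def
      using S.reachable_trans[OF vw] S.reachable_trans[OF wv] by blast
  qed (simp add: component_of_refl[OF assms(2)])
qed

lemma component_of_tail_head: "e \<in> arcs G \<Longrightarrow> component_of G (tail G e) = component_of G (head G e)"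
proof -
  assume e: "e \<in> arcs G"
  interpret S: pair_wf_digraph "mk_symmetric G" by (rule pair_wf_digraph_mk_symmetric)
  have "tail G e \<rightarrow>\<^sup>*\<^bsub>mk_symmetric G\<^esub> head G e"
    using e by (intro S.reachable_adjI) (auto simp: parcs_mk_symmetric)
  then show ?thesis using e by (simp add: component_of_eq_iff) (simp add: component_of_def)
qed

text \<open>Every vertex on a path from \<open>v\<close> is itself reachable from \<open>v\<close>,
  so the path survives in the induced subgraph; by symmetry any two vertices are then joined through
  \<open>v\<close>.\<close>

lemma connected_induce_component_of:
  assumes v: "v \<in> verts G"
  shows "Digraph_Component.connected (G \<restriction> component_of G v)"
proof -
  let ?K = "G \<restriction> component_of G v"
  interpret K: wf_digraph ?K by (rule wellformed_induce_subgraph)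
  interpret SK: pair_wf_digraph "mk_symmetric ?K" by (rule K.pair_wf_digraph_mk_symmetric)
  interpret S: pair_wf_digraph "mk_symmetric G" by (rule pair_wf_digraph_mk_symmetric)
  have from_v: "v \<rightarrow>\<^sup>*\<^bsub>mk_symmetric ?K\<^esub> w" if "v \<rightarrow>\<^sup>*\<^bsub>mk_symmetric G\<^esub> w" for w
    using that
  proof (induction rule: S.reachable_induct)
    case base
    then show ?case using component_of_refl[OF v] by (intro SK.reachable_refl) simp
  next
    case (step x y)
    have "x \<in> component_of G v" "y \<in> component_of G v"
      using step.hyps S.reachable_adj_trans by (auto simp: component_of_def)
    then have "x \<rightarrow>\<^bsub>mk_symmetric ?K\<^esub> y"
      using step.hyps(2) by (auto simp: parcs_mk_symmetric)
    then show ?case by (rule wf_digraph.reachable_adj_trans[OF SK.wf_digraph step.IH])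
  qed
  show ?thesis
  proof (rule K.connectedI)
    show "verts ?K \<noteq> {}" using component_of_refl[OF v] by auto
    fix a b assume "a \<in> verts ?K" "b \<in> verts ?K"
    then have va: "v \<rightarrow>\<^sup>*\<^bsub>mk_symmetric ?K\<^esub> a" and vb: "v \<rightarrow>\<^sup>*\<^bsub>mk_symmetric ?K\<^esub> b"
      using from_v by (auto simp: component_of_def)
    show "a \<rightarrow>\<^sup>*\<^bsub>mk_symmetric ?K\<^esub> b"
      using SK.reachable_trans[OF symmetric_reachable[OF symmetric_mk_symmetric va] vb] .
  qed
qed

text \<open>Undirected paths in \<open>K\<close> are also paths in \<open>G\<close>, so
  \<open>K\<close> stays within the class of \<open>v\<close>, and the induced subgraph has all arcs
  of \<open>G\<close> inside that class.\<close>

lemma connected_subgraph_component_of: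
  assumes K: "subgraph K G" "Digraph_Component.connected K" and v: "v \<in> verts K"
  shows "subgraph K (G \<restriction> component_of G v)"
proof -
  have "verts K \<subseteq> component_of G v"
  proof
    fix w assume "w \<in> verts K"
    then have "v \<rightarrow>\<^sup>*\<^bsub>mk_symmetric K\<^esub> w"
      using K(2) v by (simp add: connected_def strongly_connected_def)
    then show "w \<in> component_of G v"
      unfolding component_of_def
      using pre_digraph.reachable_mono[OF _ subgraph_mk_symmetric[OF K(1)]] by simp
  qed
  moreover have "wf_digraph K" using K(1) by auto
  moreover have "tail K = tail G" "head K = head G" using K(1) by (auto simp: compatible_def)
  ultimately show ?thesis
    using K(1) wf_digraph.tail_in_verts[of K] wf_digraph.head_in_verts[of K]
    by (intro subgraphI) (auto simp: compatible_def)
qed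

text \<open>The induced subgraphs on the classes are connected, and every connected subgraph sits
  inside one of them, so they are exactly the maximal ones.\<close>

lemma weak_components_eq: "weak_components G = (\<lambda>v. G \<restriction> component_of G v) ` verts G"
proof (intro set_eqI iffI)
  fix K assume "K \<in> weak_components G"
  then have K: "subgraph K G" "Digraph_Component.connected K"
    and max: "\<And>K'. K' \<noteq> K \<Longrightarrow> subgraph K K' \<Longrightarrow> \<not> (subgraph K' G \<and> Digraph_Component.connected K')"
    by (auto simp: weak_components_def max_subgraph_def)
  obtain v where v: "v \<in> verts K"
    using K(2) by (auto simp: connected_def strongly_connected_def)
  then have vG: "v \<in> verts G" using K(1) by auto
  have "K = G \<restriction> component_of G v"
    using max[of "G \<restriction> component_of G v"] connected_subgraph_component_of[OF K v]
      connected_induce_component_of[OF vG]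
      subgraph_induce_subgraphI[OF component_of_subset_verts]
    by auto
  then show "K \<in> (\<lambda>v. G \<restriction> component_of G v) ` verts G" using vG by blast
next
  fix K assume "K \<in> (\<lambda>v. G \<restriction> component_of G v) ` verts G"
  then obtain v where v: "v \<in> verts G" and K: "K = G \<restriction> component_of G v" by blast
  have "K' = K" if K': "subgraph K K'" "subgraph K' G" "Digraph_Component.connected K'" for K'
  proof -
    have "v \<in> verts K'" using subgraph_imp_subverts[OF K'(1)] component_of_refl[OF v] K by auto
    then have "subgraph K' K"
      using connected_subgraph_component_of[OF K'(2,3)] K by simp
    then show ?thesis using K'(1)
      by (intro pre_digraph.equality) (auto simp: subgraph_def compatible_def)
  qed
  then show "K \<in> weak_components G"
    using v K connected_induce_component_of subgraph_induce_subgraphI[OF component_of_subset_verts]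
    by (auto simp: weak_components_def max_subgraph_def)
qed

text \<open>An induced subgraph remembers its vertex set, so components may be counted as vertex
  classes.\<close>

lemma card_weak_components: "card (weak_components G) = card (component_of G ` verts G)"
proof -
  have "weak_components G = induce_subgraph G ` component_of G ` verts G"
    by (simp add: weak_components_eq image_image)
  moreover have "inj (induce_subgraph G)"
    by (rule injI) (metis induce_subgraph_verts)
  ultimately show ?thesis by (simp add: card_image inj_on_subset)
qed

lemma const_on_component_of:
  fixes f :: "'a \<Rightarrow> real"
  assumes diff: "\<And>e. e \<in> arcs G \<Longrightarrow> f (head G e) = f (tail G e)"
    and w: "w \<in> component_of G v"
  shows "f w = f v"
proof -
  interpret S: pair_wf_digraph "mk_symmetric G" by (rule pair_wf_digraph_mk_symmetric)
  from w have "v \<rightarrow>\<^sup>*\<^bsub>mk_symmetric G\<^esub> w" by (simp add: component_of_def)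
  then show ?thesis
    by (induction rule: S.reachable_induct) (auto simp: parcs_mk_symmetric diff)
qed

end

section \<open>Dimensions of the cut space and of the circulation space\<close>

lemma subspace_range_coboundary: "subspace (range (coboundary G))"
proof -
  have "0 = coboundary G (\<lambda>_. 0)" by (simp add: coboundary_def vec_eq_iff)
  moreover have "coboundary G f + coboundary G g = coboundary G (\<lambda>v. f v + g v)" for f g
    by (simp add: coboundary_def vec_eq_iff)
  moreover have "c *\<^sub>R coboundary G f = coboundary G (\<lambda>v. c * f v)" for c f
    by (simp add: coboundary_def vec_eq_iff algebra_simps)
  ultimately show ?thesis unfolding subspace_def by auto
qed

text \<open>On the vertices \<open>g\<close> is a combination of the indicators of points of
  \<open>W\<close>, and the coboundary is linear in the values at vertices.\<close>

lemma coboundary_eq_sum: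
  fixes G :: "('v, 'e::finite) pre_digraph"
  assumes "wf_digraph G" "finite (verts G)" "W \<subseteq> verts G"
    and zero: "\<And>v. v \<in> verts G - W \<Longrightarrow> g v = 0"
  shows "coboundary G g = (\<Sum>v\<in>W. g v *\<^sub>R coboundary G (indicator {v}))"
proof -
  interpret wf_digraph G by fact
  have fin: "finite W" using assms(2,3) by (rule rev_finite_subset)
  have val: "(\<Sum>v\<in>W. g v * indicator {v} u) = g u" if "u \<in> verts G" for u
  proof -
    have "(\<Sum>v\<in>W. g v * indicator {v} u) = (\<Sum>v\<in>W. if v = u then g v else 0)"
      by (intro sum.cong) (auto simp: indicator_def)
    then show ?thesis using fin zero[of u] that by auto
  qed
  have "(\<Sum>v\<in>W. g v * (indicator {v} (head G e) - indicator {v} (tail G e)))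
      = g (head G e) - g (tail G e)" if "e \<in> arcs G" for e
    using that by (simp add: right_diff_distrib sum_subtractf val)
  then show ?thesis by (simp add: vec_eq_iff coboundary_def)
qed

text \<open>Deleting one representative vertex per component from the vertex indicators leaves a basis
  of the cut space.\<close>

lemma dim_range_coboundary:
  fixes G :: "('v, 'e::finite) pre_digraph"
  assumes "fin_digraph G"
  shows "dim (range (coboundary G)) + card (weak_components G) = card (verts G)"
proof -
  interpret fin_digraph G by fact
  \<comment> \<open>The choice depends on \<open>v\<close> only through its class, so all vertices
    of a component share one root.\<close>
  define root where "root v = (SOME w. w \<in> component_of G v)" for v
  have root: "root v \<in> component_of G v" if "v \<in> verts G" for v
    unfolding root_def using component_of_refl[OF that] by (rule someI)
  then have root_verts: "root v \<in> verts G" if "v \<in> verts G" for v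
    using that component_of_subset_verts by blast
  have comp_root: "component_of G (root v) = component_of G v" if "v \<in> verts G" for v
    using that root root_verts component_of_eq_iff by metis
  define W where "W = verts G - root ` verts G"
  have fin: "finite W" by (simp add: W_def)
  have card_W: "card W + card (weak_components G) = card (verts G)"
  proof -
    have "component_of G ` verts G = component_of G ` root ` verts G"
      by (simp add: image_image comp_root)
    moreover have "inj_on (component_of G) (root ` verts G)"
    proof (rule inj_onI)
      fix a b assume "a \<in> root ` verts G" "b \<in> root ` verts G" "component_of G a = component_of G b"
      then show "a = b" using comp_root by (auto simp: root_def)
    qed
    ultimately have "card (weak_components G) = card (root ` verts G)"
      by (simp add: card_weak_components card_image)
    moreover have "root ` verts G \<subseteq> verts G" using root_verts by blast
    ultimately show ?thesis
      by (simp add: W_def card_Diff_subset card_mono)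
  qed
  \<comment> \<open>A potential with zero coboundary is constant on each component, and its value at
    the root is zero because roots lie outside \<open>W\<close>.\<close>
  have zero: "g v = 0"
    if "coboundary G g = 0" "\<And>v. v \<in> verts G - W \<Longrightarrow> g v = 0" "v \<in> verts G" for g v
  proof -
    have "g (head G e) = g (tail G e)" if "e \<in> arcs G" for e
    proof -
      have "coboundary G g $ e = 0" using \<open>coboundary G g = 0\<close> by simp
      then show ?thesis using that by (simp add: coboundary_def)
    qed
    then have "g (root v) = g v"
      using const_on_component_of root[OF that(3)] by blast
    then show ?thesis using that root_verts by (auto simp: W_def)
  qed
  let ?b = "\<lambda>v. coboundary G (indicator {v})"
  have indep: "c v = 0" if "(\<Sum>v\<in>W. c v *\<^sub>R ?b v) = 0" "v \<in> W" for c v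
  proof -
    define g where "g u = (if u \<in> W then c u else 0)" for u
    have "coboundary G g = (\<Sum>v\<in>W. g v *\<^sub>R ?b v)"
      by (intro coboundary_eq_sum wf_digraph) (auto simp: W_def g_def)
    also have "\<dots> = (\<Sum>v\<in>W. c v *\<^sub>R ?b v)" by (intro sum.cong) (auto simp: g_def)
    finally have "coboundary G g = 0" using that(1) by simp
    then have "g v = 0" by (rule zero) (use that(2) in \<open>auto simp: g_def W_def\<close>)
    then show ?thesis using that(2) by (simp add: g_def)
  qed
  \<comment> \<open>This passes from the family indexed by \<open>W\<close> to the set of its
    values: equal values at \<open>u\<close> and \<open>v\<close> would give a relation with
    coefficients \<open>1\<close> and \<open>-1\<close>.\<close>
  have inj: "inj_on ?b W"
  proof (rule inj_onI, rule ccontr)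
    fix u v assume uv: "u \<in> W" "v \<in> W" "?b u = ?b v" "u \<noteq> v"
    let ?c = "\<lambda>w. if w = u then 1 else if w = v then - 1 else 0 :: real"
    have "(\<Sum>w\<in>W. ?c w *\<^sub>R ?b w) = (\<Sum>w\<in>{u, v}. ?c w *\<^sub>R ?b w)"
      using uv fin by (intro sum.mono_neutral_right) auto
    also have "\<dots> = 0" using uv by simp
    finally show False using indep[of ?c u] uv(1) by simp
  qed
  have "independent (?b ` W)"
  proof (rule independent_if_scalars_zero)
    fix c x assume "(\<Sum>x\<in>?b ` W. c x *\<^sub>R x) = 0" "x \<in> ?b ` W"
    then show "c x = 0" using indep[of "\<lambda>v. c (?b v)"] by (auto simp: sum.reindex[OF inj])
  qed (simp add: fin)
  moreover have "range (coboundary G) \<subseteq> span (?b ` W)"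
  proof
    fix x assume "x \<in> range (coboundary G)"
    then obtain f where x: "x = coboundary G f" by blast
    \<comment> \<open>Subtracting a constant on each component leaves the coboundary unchanged and
      makes the potential vanish at the roots.\<close>
    define g where "g v = f v - f (root v)" for v
    have "root (root v) = root v" if "v \<in> verts G" for v
      using comp_root[OF that] by (simp add: root_def)
    then have "coboundary G g = (\<Sum>v\<in>W. g v *\<^sub>R ?b v)"
      by (intro coboundary_eq_sum wf_digraph) (auto simp: W_def g_def)
    moreover have "coboundary G g = coboundary G f"
      using component_of_tail_head by (auto simp: coboundary_def vec_eq_iff g_def root_def)
    ultimately show "x \<in> span (?b ` W)"
      using x by (auto intro!: span_sum span_scale intro: span_base)
  qed
  ultimately have "dim (range (coboundary G)) = card (?b ` W)"
    by (intro basis_card_eq_dim[symmetric]) auto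
  then show ?thesis using card_W by (simp add: card_image[OF inj])
qed

text \<open>Within the vectors supported on the arcs, circulations form the orthogonal complement of
  the cut space, so the two dimensions add up to the number of arcs.\<close>

lemma dim_circulations:
  fixes G :: "('v, 'e::finite) pre_digraph"
  assumes "fin_digraph G"
  shows "int (dim (circulations G))
    = int (card (arcs G)) - int (card (verts G)) + int (card (weak_components G))"
proof -
  let ?X = "{x :: real ^ 'e. \<forall>e. e \<notin> arcs G \<longrightarrow> x $ e = 0}"
  have "{x \<in> ?X. \<forall>y\<in>range (coboundary G). orthogonal y x} = circulations G"
    by (auto simp: circulations_def orthogonal_def)
  moreover have "dim {x \<in> ?X. \<forall>y\<in>range (coboundary G). orthogonal y x}
      + dim (range (coboundary G)) = dim ?X"
    by (intro dim_subspace_orthogonal_to_vectors subspace_range_coboundary)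
      (auto simp: subspace_def coboundary_def)
  moreover have "dim ?X = card (arcs G)"
    using dim_substandard_cart[of "arcs G", where 'a = real] by (simp only: dim_vec_eq)
  ultimately show ?thesis using dim_range_coboundary[OF assms] by simp
qed

section \<open>The isomorphism of posets and the dimension formula\<close>

theorem theorem3p2:
  fixes G :: "('v, 'e::finite) pre_digraph"
  assumes "fin_digraph G"
  shows "bij_betw (polytope_restrict G) (full_subgraphs G) {F. F face_of cycle_polytope G}
    \<and> (\<forall>H \<in> full_subgraphs G. \<forall>H' \<in> full_subgraphs G.
          arcs H \<subseteq> arcs H' \<longleftrightarrow> polytope_restrict G H \<subseteq> polytope_restrict G H')
    \<and> (\<forall>H \<in> full_subgraphs G. cycle_polytope H = polytope_restrict G H)
    \<and> (\<forall>H \<in> full_subgraphs G.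
          aff_dim (polytope_restrict G H) =
            int (card (arcs H)) - int (card (verts H)) + int (card (weak_components H)) - 1)"
proof (intro conjI ballI)
  interpret fin_digraph G by fact
  show "bij_betw (polytope_restrict G) (full_subgraphs G) {F. F face_of cycle_polytope G}"
    unfolding bij_betw_def
  proof
    show "inj_on (polytope_restrict G) (full_subgraphs G)"
    proof (rule inj_onI)
      fix H H'
      assume H: "H \<in> full_subgraphs G" "H' \<in> full_subgraphs G"
        and "polytope_restrict G H = polytope_restrict G H'"
      then have "arcs H = arcs H'"
        using full_subgraphs_arcs_mono_iff[OF H] full_subgraphs_arcs_mono_iff[OF H(2,1)] by simp
      with H show "H = H'" by (rule full_subgraph_eqI)
    qed
    show "polytope_restrict G ` full_subgraphs G = {F. F face_of cycle_polytope G}"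
      using polytope_restrict_face_of[OF wf_digraph] face_eq_polytope_restrict[OF wf_digraph]
      by blast
  qed
  show "arcs H \<subseteq> arcs H' \<longleftrightarrow> polytope_restrict G H \<subseteq> polytope_restrict G H'"
    if "H \<in> full_subgraphs G" "H' \<in> full_subgraphs G" for H H'
    using that by (rule full_subgraphs_arcs_mono_iff)
  fix H assume H: "H \<in> full_subgraphs G"
  then have sub: "subgraph H G" and full: "full H"
    and verts: "verts H = tail H ` arcs H \<union> head H ` arcs H"
    by (auto simp: full_subgraphs_def)
  interpret H: fin_digraph H using sub by (rule fin_digraph_subgraph)
  note P_eq = polytope_restrict_eq_circulation_polytope[OF sub]
  show "cycle_polytope H = polytope_restrict G H"
    by (simp add: P_eq cycle_polytope_eq_circulation_polytope H.wf_digraph)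
  show "aff_dim (polytope_restrict G H) =
      int (card (arcs H)) - int (card (verts H)) + int (card (weak_components H)) - 1"
  \<comment> \<open>Without arcs the polytope is empty, of affine dimension \<open>-1\<close>; there
    are no vertices and hence no components, so the formula agrees.\<close>
  proof (cases "arcs H = {}")
    case True
    then have "circulation_polytope H = {}"
      by (auto simp: circulation_polytope_def circulations_def)
    then show ?thesis using True verts by (simp add: P_eq H.weak_components_eq)
  next
    case False
    then show ?thesis
      using aff_dim_circulation_polytope[OF H.wf_digraph full] dim_circulations[OF H.fin_digraph]
      by (simp add: P_eq)
  qed
qed

end
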